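(* The class of $\omega$-languages recognized by deterministic strong reset Parikh automata is a strict subclass of the class of $\omega$-languages recognized by deterministic weak reset Parikh automata.
   Context: $\mathbb{N}=\{0,1,2,\dots\}$. A linear set is a set $C(\mathbf{b},P)=\{\mathbf{b}+\mathbf{p}_1z_1+\dots+\mathbf{p}_\ell z_\ell \mid z_1,\dots,z_\ell\in\mathbb{N}\}\subseteq\mathbb{N}^d$ with $\mathbf{b}\in\mathbb{N}^d$ and $P=\{\mathbf{p}_1,\dots,\mathbf{p}_\ell\}\subseteq\mathbb{N}^d$ finite ($\ell\ge 0$); a semi-linear set is a finite union of linear sets. A Parikh automaton (PA) of dimension $d\ge 1$ is a tuple $\mathcal{A}=(Q,\Sigma,q_0,\Delta,F,C)$ with a finite state set $Q$, a finite non-empty alphabet $\Sigma$, an initial state $q_0\in Q$, a finite set of labeled transitions $\Delta\subseteq Q\times\Sigma\times\mathbb{N}^d\times Q$, a set of accepting states $F\subseteq Q$, and a semi-linear set $C\subseteq\mathbb{N}^d$. It is deterministic if for every $(p,a)\in Q\times\Sigma$ there is exactly one transition $(p,a,\mathbf{v},q)\in\Delta$. A run on $\alpha=\alpha_1\alpha_2\dots\in\Sigma^\omega$ is an infinite sequence $r=r_1r_2\dots$ with $r_i=(p_{i-1},\alpha_i,\mathbf{v}_i,p_i)\in\Delta$ and $p_0=q_0$; write $\rho(r_m\dots r_n)=\sum_{i=m}^n\mathbf{v}_i$. Acceptance of a run $r$: - Strong reset PA: let $k_0=0$ and let $k_1<k_2<\dots$ be all positions $k\ge 1$ with $p_k\in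 F$; then $r$ is accepting iff this sequence is infinite and $\rho(r_{k_{i-1}+1}\dots r_{k_i})\in C$ for all $i\ge 1$. - Weak reset PA: there are infinitely many positions $0=k_0<k_1<k_2<\dots$ such that $p_{k_i}\in F$ and $\rho(r_{k_{i-1}+1}\dots r_{k_i})\in C$ for all $i\ge 1$. In each case the recognized $\omega$-language is the set of all $\alpha\in\Sigma^\omega$ on which there is an accepting run. *)

theory Defs
  imports Main "HOL-Library.Infinite_Typeclass"
begin

(* Since the dimension d is quantified inside the classes of languages below, a vector of
   N^d is represented by its coordinate function j |-> v j (j < d), set to 0 for j >= d. *)

type_synonym natvec = "nat \<Rightarrow> nat"

definition nat_space :: "nat \<Rightarrow> natvec set" where
  "nat_space d = {v. \<forall>j\<ge>d. v j = 0}"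

definition lin_set :: "natvec \<Rightarrow> natvec set \<Rightarrow> natvec set" where
  "lin_set b P = {(\<lambda>j. b j + (\<Sum>p\<in>P. p j * z p)) | z. True}"

definition is_linear :: "nat \<Rightarrow> natvec set \<Rightarrow> bool" where
  "is_linear d X \<longleftrightarrow>
    (\<exists>b P. b \<in> nat_space d \<and> finite P \<and> P \<subseteq> nat_space d \<and> X = lin_set b P)"

definition is_semilinear :: "nat \<Rightarrow> natvec set \<Rightarrow> bool" where
  "is_semilinear d X \<longleftrightarrow> (\<exists>\<X>. finite \<X> \<and> (\<forall>Y\<in>\<X>. is_linear d Y) \<and> X = \<Union>\<X>)"

record ('q, 'a) pa =
  dimension :: nat
  states :: "'q set"
  alphabet :: "'a set"
  initial :: 'q
  transitions :: "('q \<times> 'a \<times> natvec \<times> 'q) set"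
  accepting :: "'q set"
  constraint :: "natvec set"

definition parikh_automaton :: "('q, 'a) pa \<Rightarrow> bool" where
  "parikh_automaton A \<longleftrightarrow>
    dimension A \<ge> 1 \<and>
    finite (states A) \<and>
    finite (alphabet A) \<and> alphabet A \<noteq> {} \<and>
    initial A \<in> states A \<and>
    finite (transitions A) \<and>
    transitions A \<subseteq> states A \<times> alphabet A \<times> nat_space (dimension A) \<times> states A \<and>
    accepting A \<subseteq> states A \<and>
    is_semilinear (dimension A) (constraint A)"

definition deterministic :: "('q, 'a) pa \<Rightarrow> bool" where
  "deterministic A \<longleftrightarrow>
    (\<forall>p\<in>states A. \<forall>a\<in>alphabet A. \<exists>!t. t \<in> transitions A \<and> (\<exists>v q. t = (p, a, v, q)))"

(* Letters and transitions are indexed from 0: the transition number i + 1 of the run, which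
   reads the letter number i + 1 of the word, is (p i, \<alpha> i, v i, p (i + 1)). *)

definition is_run ::
  "('q, 'a) pa \<Rightarrow> (nat \<Rightarrow> 'a) \<Rightarrow> (nat \<Rightarrow> 'q) \<Rightarrow> (nat \<Rightarrow> natvec) \<Rightarrow> bool" where
  "is_run A \<alpha> p v \<longleftrightarrow> p 0 = initial A \<and> (\<forall>i. (p i, \<alpha> i, v i, p (Suc i)) \<in> transitions A)"

(* With this indexing, the transitions leading from position m to position n, numbered
   m + 1, ..., n from 1, are those with index in {m..<n}. *)

definition segment_sum :: "(nat \<Rightarrow> natvec) \<Rightarrow> nat \<Rightarrow> nat \<Rightarrow> natvec" where
  "segment_sum v m n = (\<lambda>j. \<Sum>i\<in>{m..<n}. v i j)"

(* An increasing enumeration k of the accepting positions >= 1 that is defined on all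
   indices i >= 1 exists only if there are infinitely many such positions. *)

definition strong_reset_accepting ::
  "('q, 'a) pa \<Rightarrow> (nat \<Rightarrow> 'q) \<Rightarrow> (nat \<Rightarrow> natvec) \<Rightarrow> bool" where
  "strong_reset_accepting A p v \<longleftrightarrow>
    (\<exists>k :: nat \<Rightarrow> nat. k 0 = 0 \<and> strict_mono k \<and>
      k ` {1..} = {n. n \<ge> 1 \<and> p n \<in> accepting A} \<and>
      (\<forall>i\<ge>1. segment_sum v (k (i - 1)) (k i) \<in> constraint A))"

definition weak_reset_accepting ::
  "('q, 'a) pa \<Rightarrow> (nat \<Rightarrow> 'q) \<Rightarrow> (nat \<Rightarrow> natvec) \<Rightarrow> bool" where
  "weak_reset_accepting A p v \<longleftrightarrow>
    (\<exists>k :: nat \<Rightarrow> nat. k 0 = 0 \<and> strict_mono k \<and>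
      (\<forall>i\<ge>1. p (k i) \<in> accepting A \<and>
        segment_sum v (k (i - 1)) (k i) \<in> constraint A))"

definition strong_reset_language :: "('q, 'a) pa \<Rightarrow> (nat \<Rightarrow> 'a) set" where
  "strong_reset_language A =
    {\<alpha>. range \<alpha> \<subseteq> alphabet A \<and> (\<exists>p v. is_run A \<alpha> p v \<and> strong_reset_accepting A p v)}"

definition weak_reset_language :: "('q, 'a) pa \<Rightarrow> (nat \<Rightarrow> 'a) set" where
  "weak_reset_language A =
    {\<alpha>. range \<alpha> \<subseteq> alphabet A \<and> (\<exists>p v. is_run A \<alpha> p v \<and> weak_reset_accepting A p v)}"

(* The classes collect the languages of automata over all finite non-empty alphabets
   contained in the type of letters. Taking states in nat is no restriction: see
   det_strong_reset_languagesI and det_weak_reset_languagesI. *)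

definition det_strong_reset_languages :: "(nat \<Rightarrow> 'a) set set" where
  "det_strong_reset_languages =
    {strong_reset_language A | A :: (nat, 'a) pa. parikh_automaton A \<and> deterministic A}"

definition det_weak_reset_languages :: "(nat \<Rightarrow> 'a) set set" where
  "det_weak_reset_languages =
    {weak_reset_language A | A :: (nat, 'a) pa. parikh_automaton A \<and> deterministic A}"

definition rename_states :: "('q \<Rightarrow> 'r) \<Rightarrow> ('q, 'a) pa \<Rightarrow> ('r, 'a) pa" where
  "rename_states f A =
    \<lparr>dimension = dimension A, states = f ` states A, alphabet = alphabet A,
     initial = f (initial A),
     transitions = (\<lambda>(p, a, v, q). (f p, a, v, f q)) ` transitions A,
     accepting = f ` accepting A, constraint = constraint A\<rparr>"

lemma parikh_automaton_rename_states:
  assumes "parikh_automaton A"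
  shows "parikh_automaton (rename_states f A)"
  using assms unfolding parikh_automaton_def rename_states_def by auto

lemma mem_transitions_rename_states:
  assumes "parikh_automaton A" "inj_on f (states A)" "p \<in> states A" "q \<in> states A"
  shows "(f p, a, v, f q) \<in> transitions (rename_states f A) \<longleftrightarrow> (p, a, v, q) \<in> transitions A"
proof
  assume "(f p, a, v, f q) \<in> transitions (rename_states f A)"
  then obtain p' q' where *: "(p', a, v, q') \<in> transitions A" "f p = f p'" "f q = f q'"
    by (auto simp: rename_states_def)
  then have "p' \<in> states A" "q' \<in> states A"
    using assms(1) by (auto simp: parikh_automaton_def)
  then show "(p, a, v, q) \<in> transitions A"
    using * assms(2-4) by (metis inj_onD)
next
  assume "(p, a, v, q) \<in> transitions A"
  then show "(f p, a, v, f q) \<in> transitions (rename_states f A)"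
    by (force simp: rename_states_def)
qed

lemma deterministic_rename_states:
  assumes A: "parikh_automaton A" and f: "inj_on f (states A)" and d: "deterministic A"
  shows "deterministic (rename_states f A)"
  unfolding deterministic_def
proof (intro ballI)
  fix p' a
  assume "p' \<in> states (rename_states f A)" "a \<in> alphabet (rename_states f A)"
  then obtain p where p: "p \<in> states A" "p' = f p" and a: "a \<in> alphabet A"
    by (auto simp: rename_states_def)
  obtain v q where t: "(p, a, v, q) \<in> transitions A"
    and u: "\<And>v' q'. (p, a, v', q') \<in> transitions A \<Longrightarrow> v' = v \<and> q' = q"
    using d p(1) a unfolding deterministic_def by (metis prod.inject)
  show "\<exists>!t. t \<in> transitions (rename_states f A) \<and> (\<exists>v q. t = (p', a, v, q))"
  proof (rule ex1I[of _ "(f p, a, v, f q)"])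
    show "(f p, a, v, f q) \<in> transitions (rename_states f A) \<and>
        (\<exists>v' q'. (f p, a, v, f q) = (p', a, v', q'))"
      using t p by (force simp: rename_states_def)
  next
    fix t' assume t': "t' \<in> transitions (rename_states f A) \<and> (\<exists>v q. t' = (p', a, v, q))"
    then obtain p1 v1 q1 where 1: "(p1, a, v1, q1) \<in> transitions A" "f p1 = f p"
        "t' = (f p, a, v1, f q1)"
      by (auto simp: rename_states_def p)
    then have "p1 = p"
      using A f p(1) by (auto simp: parikh_automaton_def inj_on_def)
    then show "t' = (f p, a, v, f q)" using 1 u by auto
  qed
qed

lemma is_run_states:
  assumes "parikh_automaton A" "is_run A \<alpha> p v"
  shows "p i \<in> states A"
  using assms by (auto simp: parikh_automaton_def is_run_def)

lemma ex_run_rename_states: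
  assumes A: "parikh_automaton A" and f: "inj_on f (states A)"
    and R: "\<And>p v. (\<And>i. p i \<in> states A) \<Longrightarrow> R' (f \<circ> p) v \<longleftrightarrow> R p v"
  shows "(\<exists>p v. is_run (rename_states f A) \<alpha> p v \<and> R' p v) \<longleftrightarrow>
    (\<exists>p v. is_run A \<alpha> p v \<and> R p v)"
proof
  assume "\<exists>p v. is_run (rename_states f A) \<alpha> p v \<and> R' p v"
  then obtain p v where r: "is_run (rename_states f A) \<alpha> p v" and R': "R' p v" by blast
  have "\<forall>i. \<exists>q. q \<in> states A \<and> p i = f q"
    using is_run_states[OF parikh_automaton_rename_states[OF A] r]
    by (auto simp: rename_states_def)
  then obtain q where q: "\<And>i. q i \<in> states A" and p: "\<And>i. p i = f (q i)" by metis
  have "q 0 = initial A"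
    using r p q[of 0] A f by (auto simp: is_run_def rename_states_def parikh_automaton_def inj_on_def)
  moreover have "(q i, \<alpha> i, v i, q (Suc i)) \<in> transitions A" for i
    using r p mem_transitions_rename_states[OF A f q q] by (simp add: is_run_def)
  moreover have "p = f \<circ> q" using p by auto
  ultimately show "\<exists>p v. is_run A \<alpha> p v \<and> R p v"
    using R' R[OF q] by (auto simp: is_run_def)
next
  assume "\<exists>p v. is_run A \<alpha> p v \<and> R p v"
  then obtain p v where r: "is_run A \<alpha> p v" and Rp: "R p v" by blast
  have "is_run (rename_states f A) \<alpha> (f \<circ> p) v"
    using r by (force simp: is_run_def rename_states_def)
  then show "\<exists>p v. is_run (rename_states f A) \<alpha> p v \<and> R' p v"
    using R[of p v] is_run_states[OF A r] Rp by blast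
qed

lemma mem_accepting_rename_states:
  assumes "parikh_automaton A" "inj_on f (states A)" "q \<in> states A"
  shows "f q \<in> accepting (rename_states f A) \<longleftrightarrow> q \<in> accepting A"
  using assms by (auto simp: rename_states_def parikh_automaton_def inj_on_def)

lemma constraint_rename_states: "constraint (rename_states f A) = constraint A"
  by (simp add: rename_states_def)

lemma strong_reset_language_rename_states:
  assumes "parikh_automaton A" "inj_on f (states A)"
  shows "strong_reset_language (rename_states f A) = strong_reset_language A"
proof -
  have "alphabet (rename_states f A) = alphabet A" by (simp add: rename_states_def)
  moreover have "(\<exists>p v. is_run (rename_states f A) \<alpha> p v \<and>
        strong_reset_accepting (rename_states f A) p v) \<longleftrightarrow>
      (\<exists>p v. is_run A \<alpha> p v \<and> strong_reset_accepting A p v)" for \<alpha>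
    by (rule ex_run_rename_states[OF assms])
      (simp add: strong_reset_accepting_def mem_accepting_rename_states[OF assms]
        constraint_rename_states)
  ultimately show ?thesis by (simp add: strong_reset_language_def)
qed

lemma weak_reset_language_rename_states:
  assumes "parikh_automaton A" "inj_on f (states A)"
  shows "weak_reset_language (rename_states f A) = weak_reset_language A"
proof -
  have "alphabet (rename_states f A) = alphabet A" by (simp add: rename_states_def)
  moreover have "(\<exists>p v. is_run (rename_states f A) \<alpha> p v \<and>
        weak_reset_accepting (rename_states f A) p v) \<longleftrightarrow>
      (\<exists>p v. is_run A \<alpha> p v \<and> weak_reset_accepting A p v)" for \<alpha>
    by (rule ex_run_rename_states[OF assms])
      (simp add: weak_reset_accepting_def mem_accepting_rename_states[OF assms]
        constraint_rename_states)
  ultimately show ?thesis by (simp add: weak_reset_language_def)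
qed

lemma ex_inj_on_states_nat:
  assumes "parikh_automaton A"
  obtains f :: "'q \<Rightarrow> nat" where "inj_on f (states (A :: ('q, 'a) pa))"
  using assms finite_imp_inj_to_nat_seg unfolding parikh_automaton_def by metis

lemma det_strong_reset_languagesI:
  fixes A :: "('q, 'a) pa"
  assumes "parikh_automaton A" "deterministic A"
  shows "strong_reset_language A \<in> det_strong_reset_languages"
proof -
  obtain f :: "'q \<Rightarrow> nat" where f: "inj_on f (states A)"
    using ex_inj_on_states_nat[OF assms(1)] .
  show ?thesis
    using parikh_automaton_rename_states[OF assms(1), of f]
      deterministic_rename_states[OF assms(1) f assms(2)]
      strong_reset_language_rename_states[OF assms(1) f]
    unfolding det_strong_reset_languages_def by blast
qed

lemma det_weak_reset_languagesI:
  fixes A :: "('q, 'a) pa"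
  assumes "parikh_automaton A" "deterministic A"
  shows "weak_reset_language A \<in> det_weak_reset_languages"
proof -
  obtain f :: "'q \<Rightarrow> nat" where f: "inj_on f (states A)"
    using ex_inj_on_states_nat[OF assms(1)] .
  show ?thesis
    using parikh_automaton_rename_states[OF assms(1), of f]
      deterministic_rename_states[OF assms(1) f assms(2)]
      weak_reset_language_rename_states[OF assms(1) f]
    unfolding det_weak_reset_languages_def by blast
qed

end

(* Strong reset automata become weak ones by counting the visits of accepting states in an additional
   coordinate and requiring this count to be 1 at each reset: no accepting position can be skipped.

   Strictness is witnessed by the words over {a,b,c} that split into infinitely many factors
   with at least as many a's as b's. If a deterministic strong reset automaton recognizes this language,
   then its run on a^\<omega> visits the same accepting state after a^m and after a^n for some 1 <= m < n.
   Both visits reset the counters, so a^m and a^n have the same continuations in the language.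
   But a^n b^n c^\<omega> is in the language, and a^m b^n c^\<omega> is not. *)

theory Submission
  imports Defs "HOL-Library.Infinite_Set"
begin

section \<open>Strong reset languages are weak reset languages\<close>

definition count_accepting :: "('q, 'a) pa \<Rightarrow> ('q, 'a) pa" where
  "count_accepting A =
    \<lparr>dimension = Suc (dimension A), states = states A, alphabet = alphabet A,
     initial = initial A,
     transitions =
       (\<lambda>(p, a, v, q). (p, a, v(dimension A := of_bool (q \<in> accepting A)), q)) ` transitions A,
     accepting = accepting A,
     constraint = (\<lambda>v. v(dimension A := 1)) ` constraint A\<rparr>"

lemma mem_transitions_count_accepting:
  "(p, a, v, q) \<in> transitions (count_accepting A) \<longleftrightarrow>
    (\<exists>u. (p, a, u, q) \<in> transitions A \<and> v = u(dimension A := of_bool (q \<in> accepting A)))"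
  by (force simp: count_accepting_def)

text \<open>The periods vanish at coordinate \<open>d\<close>, so the update affects only the
  base.\<close>

lemma lin_set_upd:
  assumes "P \<subseteq> nat_space d"
  shows "(\<lambda>v. v(d := n)) ` lin_set b P = lin_set (b(d := n)) P"
proof -
  have "(\<Sum>p\<in>P. p d * z p) = 0" for z
    using assms by (auto simp: nat_space_def intro!: sum.neutral)
  then have eq: "(\<lambda>j. b j + (\<Sum>p\<in>P. p j * z p))(d := n) =
      (\<lambda>j. (b(d := n)) j + (\<Sum>p\<in>P. p j * z p))" for z
    by auto
  then show ?thesis
    unfolding lin_set_def eq[symmetric] by blast
qed

lemma is_semilinear_upd:
  assumes "is_semilinear d X"
  shows "is_semilinear (Suc d) ((\<lambda>v. v(d := n)) ` X)"
proof -
  obtain \<X> where \<X>: "finite \<X>" "\<And>Y. Y \<in> \<X> \<Longrightarrow> is_linear d Y" "X = \<Union>\<X>"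
    using assms unfolding is_semilinear_def by blast
  have "is_linear (Suc d) ((\<lambda>v. v(d := n)) ` Y)" if Y: "Y \<in> \<X>" for Y
  proof -
    obtain b P where "b \<in> nat_space d" "finite P" and P: "P \<subseteq> nat_space d" and "Y = lin_set b P"
      using \<X>(2)[OF Y] unfolding is_linear_def by blast
    moreover from this have "b(d := n) \<in> nat_space (Suc d)" "P \<subseteq> nat_space (Suc d)"
      by (auto simp: nat_space_def)
    ultimately show ?thesis
      unfolding is_linear_def using lin_set_upd[OF P] by metis
  qed
  moreover have "(\<lambda>v. v(d := n)) ` X = \<Union> ((`) (\<lambda>v. v(d := n)) ` \<X>)"
    using \<X>(3) by blast
  ultimately show ?thesis
    unfolding is_semilinear_def using \<X>(1) by (metis (no_types, lifting) finite_imageI imageE)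
qed

section \<open>Well-formedness, determinism and runs of the counting automaton\<close>

lemma parikh_automaton_count_accepting:
  assumes "parikh_automaton A"
  shows "parikh_automaton (count_accepting A)"
proof -
  have "transitions (count_accepting A) \<subseteq>
      states A \<times> alphabet A \<times> nat_space (Suc (dimension A)) \<times> states A"
    using assms by (fastforce simp: mem_transitions_count_accepting parikh_automaton_def nat_space_def)
  then show ?thesis
    using assms is_semilinear_upd[of "dimension A" "constraint A" 1]
    by (simp add: parikh_automaton_def count_accepting_def)
qed

lemma deterministic_transition_unique:
  assumes "parikh_automaton A" "deterministic A"
    and "(p, a, v, q) \<in> transitions A" "(p, a, v', q') \<in> transitions A"
  shows "v = v' \<and> q = q'"
proof -
  have "p \<in> states A" "a \<in> alphabet A"
    using assms(1,3) by (auto simp: parikh_automaton_def)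
  then show ?thesis
    using assms(2-4) unfolding deterministic_def by (metis prod.inject)
qed

lemma deterministic_count_accepting:
  assumes "parikh_automaton A" "deterministic A"
  shows "deterministic (count_accepting A)"
  unfolding deterministic_def
proof (intro ballI)
  fix p a
  assume "p \<in> states (count_accepting A)" "a \<in> alphabet (count_accepting A)"
  then have "p \<in> states A" "a \<in> alphabet A"
    by (simp_all add: count_accepting_def)
  then obtain v q where t: "(p, a, v, q) \<in> transitions A"
    using assms(2) unfolding deterministic_def by metis
  have "(p, a, w, q') \<in> transitions (count_accepting A) \<longleftrightarrow>
      w = v(dimension A := of_bool (q \<in> accepting A)) \<and> q' = q" for w q'
    unfolding mem_transitions_count_accepting
    using t deterministic_transition_unique[OF assms t] by blast
  then show "\<exists>!t. t \<in> transitions (count_accepting A) \<and> (\<exists>v q. t = (p, a, v, q))"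
    by (intro ex1I[of _ "(p, a, v(dimension A := of_bool (q \<in> accepting A)), q)"]) auto
qed

lemma is_run_count_accepting:
  "is_run (count_accepting A) \<alpha> p w \<longleftrightarrow>
    (\<exists>v. is_run A \<alpha> p v \<and> w = (\<lambda>i. (v i)(dimension A := of_bool (p (Suc i) \<in> accepting A))))"
  (is "?L \<longleftrightarrow> ?R")
proof
  assume ?L
  then have "\<forall>i. \<exists>u. (p i, \<alpha> i, u, p (Suc i)) \<in> transitions A \<and>
      w i = u(dimension A := of_bool (p (Suc i) \<in> accepting A))"
    by (simp add: is_run_def mem_transitions_count_accepting)
  then obtain v where "\<And>i. (p i, \<alpha> i, v i, p (Suc i)) \<in> transitions A \<and>
      w i = (v i)(dimension A := of_bool (p (Suc i) \<in> accepting A))"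
    by metis
  with \<open>?L\<close> show ?R
    by (intro exI[of _ v]) (auto simp: is_run_def count_accepting_def)
next
  assume ?R
  then show ?L
    by (auto simp: is_run_def mem_transitions_count_accepting) (simp add: count_accepting_def)
qed

section \<open>Segment sums and acceptance in the counting automaton\<close>

lemma is_semilinear_subset_nat_space:
  assumes "is_semilinear d X"
  shows "X \<subseteq> nat_space d"
proof -
  have subset: "Y \<subseteq> nat_space d" if lin: "is_linear d Y" for Y
  proof -
    obtain b P where "b \<in> nat_space d" "P \<subseteq> nat_space d" and Y: "Y = lin_set b P"
      using lin unfolding is_linear_def by blast
    then show ?thesis
      unfolding Y by (auto simp: lin_set_def nat_space_def intro!: sum.neutral)
  qed
  obtain \<X> where "\<forall>Y\<in>\<X>. is_linear d Y" and X: "X = \<Union>\<X>"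
    using assms unfolding is_semilinear_def by blast
  then show ?thesis unfolding X using subset by blast
qed

lemma card_filter_Suc_eq_1_iff:
  assumes "m < n" "P n"
  shows "card {i \<in> {m..<n}. P (Suc i)} = 1 \<longleftrightarrow> (\<forall>l. m < l \<and> l < n \<longrightarrow> \<not> P l)"
    (is "card ?S = 1 \<longleftrightarrow> ?R")
proof
  \<comment> \<open>Index \<open>n - 1\<close> stands for position \<open>n\<close>, which always
    counts; cardinality 1 leaves room for no other.\<close>
  have n: "n - 1 \<in> ?S" using assms by auto
  assume "card ?S = 1"
  with n have S: "?S = {n - 1}" by (metis card_1_singletonE singletonD)
  show ?R
  proof (intro allI impI notI)
    fix l assume "m < l \<and> l < n" "P l"
    then have "l - 1 \<in> ?S" by auto
    then have "l - 1 = n - 1" unfolding S by (rule singletonD)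
    with \<open>m < l \<and> l < n\<close> show False by linarith
  qed
next
  assume R: ?R
  have "i = n - 1" if "i \<in> ?S" for i
  proof -
    have "\<not> Suc i < n" using R that by auto
    with that show ?thesis by auto
  qed
  then have "?S = {n - 1}" using assms by auto
  then show "card ?S = 1" by simp
qed

text \<open>The old coordinates add up as before, and the new one counts the accepting positions in
  \<open>{m<..n}\<close>. Position \<open>n\<close> contributes 1, so the count is 1 exactly when
  none lies strictly in between.\<close>

lemma segment_sum_count_accepting:
  assumes A: "parikh_automaton A" and r: "is_run A \<alpha> p v" and "m < n" "p n \<in> accepting A"
  shows "segment_sum (\<lambda>i. (v i)(dimension A := of_bool (p (Suc i) \<in> accepting A))) m n
      \<in> constraint (count_accepting A) \<longleftrightarrow>
    segment_sum v m n \<in> constraint A \<and> (\<forall>l. m < l \<and> l < n \<longrightarrow> p l \<notin> accepting A)"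
proof -
  let ?d = "dimension A"
  let ?N = "card {i \<in> {m..<n}. p (Suc i) \<in> accepting A}"
  have "v i \<in> nat_space ?d" for i
    using A r unfolding is_run_def parikh_automaton_def by blast
  then have "v i ?d = 0" for i
    by (simp add: nat_space_def)
  then have s: "segment_sum v m n ?d = 0"
    by (simp add: segment_sum_def)
  \<comment> \<open>Segment sums of \<open>v\<close> and members of the constraint both vanish at
    \<open>?d\<close>, so overwriting that coordinate loses no information.\<close>
  have C: "x ?d = 0" if "x \<in> constraint A" for x
    using is_semilinear_subset_nat_space A that
    by (fastforce simp: parikh_automaton_def nat_space_def)
  have eq: "segment_sum (\<lambda>i. (v i)(?d := of_bool (p (Suc i) \<in> accepting A))) m n =
      (segment_sum v m n)(?d := ?N)"
  proof
    fix j
    show "segment_sum (\<lambda>i. (v i)(?d := of_bool (p (Suc i) \<in> accepting A))) m n j =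
        ((segment_sum v m n)(?d := ?N)) j"
      by (cases "j = ?d")
        (simp_all add: segment_sum_def of_bool_def sum.If_cases Collect_conj_eq Int_assoc
          atLeastLessThan_def atLeast_def lessThan_def)
  qed
  have "(segment_sum v m n)(?d := ?N) \<in> constraint (count_accepting A) \<longleftrightarrow>
      segment_sum v m n \<in> constraint A \<and> ?N = 1" (is "?L \<longleftrightarrow> ?R")
  proof
    assume ?L
    then obtain x where x: "x \<in> constraint A" "(segment_sum v m n)(?d := ?N) = x(?d := 1)"
      by (auto simp: count_accepting_def)
    then have "segment_sum v m n j = x j" for j
      using s C[OF x(1)] by (cases "j = ?d") (auto simp: fun_eq_iff split: if_splits)
    then have "segment_sum v m n = x" by (rule ext)
    moreover have "?N = 1" using fun_cong[OF x(2), of ?d] by simp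
    ultimately show ?R using x(1) by simp
  next
    assume ?R
    then show ?L by (simp add: count_accepting_def)
  qed
  then show ?thesis
    unfolding eq using card_filter_Suc_eq_1_iff[of m n "\<lambda>i. p i \<in> accepting A"] assms(3,4) by simp
qed

text \<open>Take the least index at which \<open>k\<close> reaches \<open>n\<close>; it is positive
  because \<open>k 0 < n\<close>.\<close>

lemma strict_mono_bracket:
  fixes k :: "nat \<Rightarrow> nat"
  assumes "strict_mono k" "k 0 < n"
  obtains i where "k i < n" "n \<le> k (Suc i)"
proof -
  define j where "j = (LEAST j. n \<le> k j)"
  have j: "n \<le> k j"
    unfolding j_def using strict_mono_imp_increasing[OF assms(1), of n] by (rule LeastI)
  then obtain i where i: "j = Suc i" using assms(2) by (cases j) auto
  then have "k i < n" using not_less_Least[of i "\<lambda>j. n \<le> k j"] by (simp add: j_def)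
  with j i that show ?thesis by simp
qed

text \<open>The same \<open>k\<close> serves both conditions. If it enumerates all accepting
  positions, none lies between consecutive resets; conversely, a count of 1 on every segment
  prevents skipping one.\<close>

lemma strong_reset_accepting_iff_weak:
  assumes "parikh_automaton A" "is_run A \<alpha> p v"
  shows "strong_reset_accepting A p v \<longleftrightarrow> weak_reset_accepting (count_accepting A) p
    (\<lambda>i. (v i)(dimension A := of_bool (p (Suc i) \<in> accepting A)))" (is "_ \<longleftrightarrow> weak_reset_accepting _ _ ?w")
proof -
  have acc: "accepting (count_accepting A) = accepting A" by (simp add: count_accepting_def)
  note seg = segment_sum_count_accepting[OF assms]
  have "k ` {1..} = {n. n \<ge> 1 \<and> p n \<in> accepting A} \<and>
        (\<forall>i\<ge>1. segment_sum v (k (i - 1)) (k i) \<in> constraint A) \<longleftrightarrow>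
      (\<forall>i\<ge>1. p (k i) \<in> accepting A \<and>
        segment_sum ?w (k (i - 1)) (k i) \<in> constraint (count_accepting A))" (is "?L \<longleftrightarrow> ?R")
    if k: "k 0 = 0" "strict_mono k" for k :: "nat \<Rightarrow> nat"
  proof -
    have lt: "k (i - 1) < k i" if "i \<ge> 1" for i
      using k(2) that by (simp add: strict_mono_less)
    show ?thesis
    proof
      assume ?L
      then have im: "k ` {1..} = {n. n \<ge> 1 \<and> p n \<in> accepting A}"
        and C: "\<And>i. i \<ge> 1 \<Longrightarrow> segment_sum v (k (i - 1)) (k i) \<in> constraint A"
        by simp_all
      show ?R
      proof (intro allI impI)
        fix i :: nat assume i: "i \<ge> 1"
        then have "k i \<in> k ` {1..}" by simp
        then have "p (k i) \<in> accepting A" unfolding im by simp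
        moreover have "p l \<notin> accepting A" if l: "k (i - 1) < l" "l < k i" for l
        proof
          assume "p l \<in> accepting A"
          then have "l \<in> k ` {1..}" unfolding im using l by simp
          then obtain j where "l = k j" by (rule imageE)
          \<comment> \<open>No index lies strictly between \<open>i - 1\<close> and
            \<open>i\<close>, so no value of \<open>k\<close> lies strictly between theirs.\<close>
          with l k(2) i show False by (simp add: strict_mono_less)
        qed
        ultimately show "p (k i) \<in> accepting A \<and>
            segment_sum ?w (k (i - 1)) (k i) \<in> constraint (count_accepting A)"
          using C[OF i] seg[OF lt[OF i]] by simp
      qed
    next
      assume R: ?R
      have s: "segment_sum v (k (i - 1)) (k i) \<in> constraint A"
        "\<And>l. k (i - 1) < l \<Longrightarrow> l < k i \<Longrightarrow> p l \<notin> accepting A" if "i \<ge> 1" for i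
        using R seg[OF lt[OF that]] that by simp_all
      have "k ` {1..} = {n. n \<ge> 1 \<and> p n \<in> accepting A}"
      proof (intro equalityI subsetI)
        fix n assume "n \<in> k ` {1..}"
        then obtain i where i: "i \<ge> 1" "n = k i" by auto
        then show "n \<in> {n. n \<ge> 1 \<and> p n \<in> accepting A}"
          using R lt[OF i(1)] by simp
      next
        fix n assume n: "n \<in> {n. n \<ge> 1 \<and> p n \<in> accepting A}"
        \<comment> \<open>Every accepting position falls into some reset interval; the count
          excludes its interior, leaving only the right end.\<close>
        then obtain i where "k i < n" "n \<le> k (Suc i)"
          using strict_mono_bracket[OF k(2), of n] k(1) by auto
        then have "n = k (Suc i)" using n s(2)[of "Suc i" n] by fastforce
        then show "n \<in> k ` {1..}" by simp
      qed
      with s(1) show ?L by simp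
    qed
  qed
  then show ?thesis
    unfolding strong_reset_accepting_def weak_reset_accepting_def acc
    by (intro arg_cong[where f = Ex] ext) (simp cong: conj_cong)
qed

lemma weak_reset_language_count_accepting:
  assumes "parikh_automaton A"
  shows "weak_reset_language (count_accepting A) = strong_reset_language A"
proof -
  have "alphabet (count_accepting A) = alphabet A" by (simp add: count_accepting_def)
  then show ?thesis
    unfolding weak_reset_language_def strong_reset_language_def is_run_count_accepting
    using strong_reset_accepting_iff_weak[OF assms] by blast
qed

lemma det_strong_reset_languages_subset_weak:
  "det_strong_reset_languages \<subseteq> det_weak_reset_languages"
proof
  fix L :: "(nat \<Rightarrow> 'a) set"
  assume "L \<in> det_strong_reset_languages"
  then obtain A :: "(nat, 'a) pa"
    where A: "parikh_automaton A" "deterministic A" "L = strong_reset_language A"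
    unfolding det_strong_reset_languages_def by blast
  then show "L \<in> det_weak_reset_languages"
    using det_weak_reset_languagesI[OF parikh_automaton_count_accepting deterministic_count_accepting]
      weak_reset_language_count_accepting by metis
qed

section \<open>Splicing accepting runs of strong reset automata\<close>

text \<open>Splicing shifts the indices of an enumeration. This form avoids them: it speaks only of
  positions and of neighbouring resets, so it can be checked locally.\<close>

lemma strong_reset_accepting_iff:
  "strong_reset_accepting A p v \<longleftrightarrow>
    infinite {n. n \<ge> 1 \<and> p n \<in> accepting A} \<and>
    (\<forall>m n. m < n \<and> (m = 0 \<or> p m \<in> accepting A) \<and> p n \<in> accepting A \<and>
      (\<forall>l. m < l \<and> l < n \<longrightarrow> p l \<notin> accepting A) \<longrightarrow> segment_sum v m n \<in> constraint A)"
  (is "_ \<longleftrightarrow> infinite ?S \<and> ?segs")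
proof
  assume "strong_reset_accepting A p v"
  then obtain k :: "nat \<Rightarrow> nat" where k: "strict_mono k" "k 0 = 0" "k ` {1..} = ?S"
      "\<forall>i\<ge>1. segment_sum v (k (i - 1)) (k i) \<in> constraint A"
    unfolding strong_reset_accepting_def by blast
  have "infinite ?S"
    unfolding k(3)[symmetric]
    using infinite_Ici finite_imageD[OF _ strict_mono_imp_inj_on[OF k(1)]] by (rule contrapos_nn)
  moreover have ?segs
  proof (intro allI impI, elim conjE)
    fix m n
    assume mn: "m < n" "m = 0 \<or> p m \<in> accepting A" "p n \<in> accepting A"
      and none: "\<forall>l. m < l \<and> l < n \<longrightarrow> p l \<notin> accepting A"
    then have "n \<in> k ` {1..}" unfolding k(3) by simp
    then obtain i where i: "n = k i" by blast
    have "\<exists>j. m = k j"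
    proof (cases "m = 0")
      case False
      then have "m \<in> k ` {1..}" unfolding k(3) using mn by simp
      then show ?thesis by blast
    qed (use k(2) in auto)
    then obtain j where j: "m = k j" by blast
    then have "j < i" using mn(1) i k(1) by (simp add: strict_mono_less)
    have "k (Suc j) \<in> ?S" unfolding k(3)[symmetric] by simp
    \<comment> \<open>\<open>k (Suc j)\<close> is an accepting position after \<open>m\<close>; if
      \<open>i\<close> exceeded \<open>Suc j\<close>, it would also lie before
      \<open>n\<close>.\<close>
    then have "\<not> (m < k (Suc j) \<and> k (Suc j) < n)" using none by auto
    with \<open>j < i\<close> have "i = Suc j"
      using k(1) i j by (simp add: strict_mono_less)
    then show "segment_sum v m n \<in> constraint A" using k(4)[rule_format, of i] i j by simp
  qed
  ultimately show "infinite ?S \<and> ?segs" by blast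
next
  assume R: "infinite ?S \<and> ?segs"
  \<comment> \<open>The first segment starts at 0 whether or not the initial state is accepting.
    Since \<open>?S\<close> has only positive members, inserting 0 makes it the value at index
    0.\<close>
  define k where "k = enumerate (insert 0 ?S)"
  have inf: "infinite (insert 0 ?S)" using R by simp
  have mono: "strict_mono k" unfolding k_def by (rule strict_mono_enumerate[OF inf])
  have range: "range k = insert 0 ?S" unfolding k_def by (rule range_enumerate[OF inf])
  have 0: "k 0 = 0" unfolding k_def enumerate_0 by (rule Least_equality) auto
  have "{1..} = UNIV - {0 :: nat}" by auto
  then have "k ` {1..} = range k - {0}"
    using image_set_diff[OF strict_mono_imp_inj_on[OF mono], of UNIV "{0}"] 0 by simp
  also have "\<dots> = ?S" unfolding range by auto
  finally have im: "k ` {1..} = ?S" .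
  have "segment_sum v (k (i - 1)) (k i) \<in> constraint A" if i: "i \<ge> 1" for i
  proof -
    have "k (i - 1) < k i" using mono i by (simp add: strict_mono_less)
    moreover have "k (i - 1) \<in> range k" by simp
    then have "k (i - 1) = 0 \<or> p (k (i - 1)) \<in> accepting A" unfolding range by blast
    moreover have "k i \<in> k ` {1..}" using i by simp
    then have "p (k i) \<in> accepting A" unfolding im by blast
    moreover have "p l \<notin> accepting A" if l: "k (i - 1) < l" "l < k i" for l
    proof
      assume "p l \<in> accepting A"
      with l have "l \<in> range k" unfolding range by simp
      then obtain j where "l = k j" by blast
      with l mono i show False by (simp add: strict_mono_less)
    qed
    ultimately show ?thesis using R by blast
  qed
  with 0 mono im show "strong_reset_accepting A p v"
    unfolding strong_reset_accepting_def by blast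
qed

text \<open>One operation for letters, labels and states, so that a spliced run is the splice of two
  runs. Index \<open>m\<close> already belongs to \<open>g\<close>, whence the seam condition
  \<open>p m = q n\<close> below.\<close>

definition splice_at :: "nat \<Rightarrow> nat \<Rightarrow> (nat \<Rightarrow> 'b) \<Rightarrow> (nat \<Rightarrow> 'b) \<Rightarrow> nat \<Rightarrow> 'b" where
  "splice_at m n f g = (\<lambda>i. if i < m then f i else g (n + (i - m)))"

lemma is_run_splice_at:
  assumes "is_run A \<alpha> p v" "is_run A \<beta> q w" "p m = q n"
  shows "is_run A (splice_at m n \<alpha> \<beta>) (splice_at m n p q) (splice_at m n v w)"
  unfolding is_run_def
proof (intro conjI allI)
  show "splice_at m n p q 0 = initial A"
    using assms by (cases "m = 0") (auto simp: splice_at_def is_run_def)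
next
  fix i
  \<comment> \<open>At the seam \<open>Suc i = m\<close> the splice takes \<open>q n\<close>, which
    equals \<open>p m\<close>.\<close>
  have "splice_at m n p q (Suc i) = p (Suc i)" if "i < m"
    using that assms(3) by (cases "Suc i = m") (auto simp: splice_at_def)
  moreover have "splice_at m n p q (Suc i) = q (Suc (n + (i - m)))" if "\<not> i < m"
    using that by (simp add: splice_at_def Suc_diff_le)
  ultimately show "(splice_at m n p q i, splice_at m n \<alpha> \<beta> i, splice_at m n v w i, splice_at m n p q (Suc i))
      \<in> transitions A"
    using assms(1,2) by (cases "i < m") (auto simp: splice_at_def is_run_def)
qed

text \<open>The state at the seam is accepting, so every segment between consecutive resets lies
  wholly in one of the two runs and inherits its constraint from there.\<close>

lemma strong_reset_accepting_splice_at: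
  assumes acc: "strong_reset_accepting A p v" "strong_reset_accepting A q w"
    and pq: "p m = q n" "q n \<in> accepting A"
  shows "strong_reset_accepting A (splice_at m n p q) (splice_at m n v w)"
proof -
  let ?r = "splice_at m n p q" and ?u = "splice_at m n v w"
  note acc = acc[unfolded strong_reset_accepting_iff]
  have le: "?r i = p i" if "i \<le> m" for i
    using that pq by (cases "i = m") (auto simp: splice_at_def)
  have ge: "?r (m + i) = q (n + i)" for i by (simp add: splice_at_def)
  have "infinite {i. i \<ge> 1 \<and> ?r i \<in> accepting A}"
    unfolding infinite_nat_iff_unbounded
  proof
    fix N
    \<comment> \<open>Position \<open>j\<close> of \<open>q\<close> reappears at
      \<open>m + (j - n)\<close>, which exceeds \<open>N\<close> for this choice.\<close>
    obtain j where j: "j > n + N" "q j \<in> accepting A"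
      using acc(2) unfolding infinite_nat_iff_unbounded by (metis (mono_tags, lifting) mem_Collect_eq)
    then have "?r (m + (j - n)) \<in> accepting A" using ge[of "j - n"] by simp
    with j(1) show "\<exists>i>N. i \<in> {i. i \<ge> 1 \<and> ?r i \<in> accepting A}"
      by (intro exI[of _ "m + (j - n)"]) auto
  qed
  moreover have "segment_sum ?u i j \<in> constraint A"
    if ij: "i < j" "i = 0 \<or> ?r i \<in> accepting A" "?r j \<in> accepting A"
      and none: "\<And>l. i < l \<Longrightarrow> l < j \<Longrightarrow> ?r l \<notin> accepting A" for i j
  proof -
    consider "j \<le> m" | "i < m" "m < j" | "m \<le> i" by linarith
    then show ?thesis
    proof cases
      case 1
      have "segment_sum ?u i j = segment_sum v i j"
        using 1 by (simp add: segment_sum_def splice_at_def)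
      moreover have "\<forall>l. i < l \<and> l < j \<longrightarrow> p l \<notin> accepting A"
        using none le 1 by auto
      moreover have "i = 0 \<or> p i \<in> accepting A" "p j \<in> accepting A"
        using ij le[of i] le[of j] 1 by auto
      ultimately show ?thesis
        using acc(1) ij(1) by metis
    next
      case 2
      \<comment> \<open>The seam \<open>m\<close> would be an accepting position strictly inside the
        segment.\<close>
      then show ?thesis using none[of m] pq le[of m] by simp
    next
      case 3
      define i' j' where "i' = i - m" and "j' = j - m"
      have i: "i = m + i'" and j: "j = m + j'" using 3 ij(1) by (auto simp: i'_def j'_def)
      have "segment_sum ?u i j = segment_sum w (n + i') (n + j')"
      proof
        fix t
        show "segment_sum ?u i j t = segment_sum w (n + i') (n + j') t"
          unfolding segment_sum_def i j
          by (rule sum.reindex_bij_witness[of _ "\<lambda>l. m + (l - n)" "\<lambda>l. n + (l - m)"])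
            (auto simp: splice_at_def)
      qed
      moreover have "q l \<notin> accepting A" if "n + i' < l" "l < n + j'" for l
        using none[of "m + (l - n)"] ge[of "l - n"] that i j by auto
      \<comment> \<open>If \<open>i = 0\<close>, then \<open>m = 0\<close> and the segment starts at
        position \<open>n\<close> of \<open>q\<close>, possibly not 0; it is a reset there because
        \<open>q n\<close> is accepting.\<close>
      moreover have "q (n + i') \<in> accepting A"
        using ij(2) ge[of i'] i pq by (cases "i' = 0") auto
      moreover have "q (n + j') \<in> accepting A" using ij(3) ge[of j'] j by simp
      ultimately show ?thesis using acc(2) ij(1) i j by auto
    qed
  qed
  ultimately show ?thesis unfolding strong_reset_accepting_iff by blast
qed

section \<open>Determinism and the exchange of prefixes\<close>

lemma deterministic_run_unique:
  assumes "parikh_automaton A" "deterministic A" "is_run A \<alpha> p v" "is_run A \<beta> q w"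
    and "\<And>i. i < n \<Longrightarrow> \<alpha> i = \<beta> i"
  shows "p n = q n"
  using assms(5)
proof (induction n)
  case 0
  then show ?case using assms(3,4) by (simp add: is_run_def)
next
  case (Suc n)
  then have "p n = q n" "\<alpha> n = \<beta> n" by auto
  then show ?case
    using assms(3,4) deterministic_transition_unique[OF assms(1,2)]
    unfolding is_run_def by metis
qed

text \<open>Reaching the same accepting state makes two prefixes interchangeable, because the counters
  are reset; on a single accepted word some accepting state is reached infinitely often.\<close>

lemma strong_reset_language_exchange:
  assumes A: "parikh_automaton A" "deterministic A" and \<alpha>: "\<alpha> \<in> strong_reset_language A"
  obtains m n where "m < n"
    "\<And>\<beta>. \<beta> \<in> strong_reset_language A \<Longrightarrow> (\<And>i. i < n \<Longrightarrow> \<beta> i = \<alpha> i) \<Longrightarrow>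
      splice_at m n \<alpha> \<beta> \<in> strong_reset_language A"
proof -
  obtain p v where r: "is_run A \<alpha> p v" and acc: "strong_reset_accepting A p v"
    and ran: "range \<alpha> \<subseteq> alphabet A"
    using \<alpha> unfolding strong_reset_language_def by blast
  let ?S = "{n. n \<ge> 1 \<and> p n \<in> accepting A}"
  have inf: "infinite ?S" using acc unfolding strong_reset_accepting_iff by blast
  \<comment> \<open>Pigeonhole: infinitely many accepting positions share finitely many
    states.\<close>
  have "finite (p ` ?S)"
    using is_run_states[OF A(1) r] A(1)
    by (auto simp: parikh_automaton_def intro: finite_subset[of _ "states A"])
  with inf have "\<not> inj_on p ?S" using finite_imageD by blast
  then obtain i j where "i \<in> ?S" "j \<in> ?S" "p i = p j" "i \<noteq> j" unfolding inj_on_def by blast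
  then obtain m n where mn: "m < n" "p m = p n" "p n \<in> accepting A"
    by (cases i j rule: linorder_cases) auto
  have "splice_at m n \<alpha> \<beta> \<in> strong_reset_language A"
    if \<beta>: "\<beta> \<in> strong_reset_language A" and eq: "\<And>i. i < n \<Longrightarrow> \<beta> i = \<alpha> i" for \<beta>
  proof -
    obtain q w where q: "is_run A \<beta> q w" "strong_reset_accepting A q w" "range \<beta> \<subseteq> alphabet A"
      using \<beta> unfolding strong_reset_language_def by blast
    \<comment> \<open>By determinism, the common prefix of length \<open>n\<close> leads the run on
      \<open>\<beta>\<close> to the seam state.\<close>
    have "q n = p n" using deterministic_run_unique[OF A q(1) r] eq by blast
    then have "is_run A (splice_at m n \<alpha> \<beta>) (splice_at m n p q) (splice_at m n v w)"
      "strong_reset_accepting A (splice_at m n p q) (splice_at m n v w)"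
      using is_run_splice_at[OF r q(1)] strong_reset_accepting_splice_at[OF acc q(2)] mn by auto
    moreover have "range (splice_at m n \<alpha> \<beta>) \<subseteq> alphabet A"
      using ran q(3) by (auto simp: splice_at_def)
    ultimately show ?thesis unfolding strong_reset_language_def by blast
  qed
  with mn(1) show ?thesis using that by blast
qed

section \<open>The separating language\<close>

definition weight :: "'a \<Rightarrow> 'a \<Rightarrow> 'a \<Rightarrow> natvec" where
  "weight a b l = (\<lambda>j. if j = 0 then of_bool (l = a) else if j = 1 then of_bool (l = b) else 0)"

definition dominated :: "natvec set" where
  "dominated = {x \<in> nat_space 2. x 1 \<le> x 0}"

text \<open>The only state is accepting, so a weak run may reset after any letter, and only the
  constraint restricts the factors.\<close>

definition dominated_pa :: "'a \<Rightarrow> 'a \<Rightarrow> 'a \<Rightarrow> (nat, 'a) pa" where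
  "dominated_pa a b c =
    \<lparr>dimension = 2, states = {0}, alphabet = {a, b, c}, initial = 0,
     transitions = (\<lambda>l. (0, l, weight a b l, 0)) ` {a, b, c},
     accepting = {0}, constraint = dominated\<rparr>"

lemma is_semilinear_dominated: "is_semilinear 2 dominated"
proof -
  \<comment> \<open>The padded vectors (1,0) and (1,1) generate the set. Being distinct, they give
    two terms in the sum over \<open>{e, f}\<close>.\<close>
  define e f :: natvec where "e = (\<lambda>j. of_bool (j = 0))" and "f = (\<lambda>j. of_bool (j < 2))"
  have "f 1 \<noteq> e 1" by (simp add: e_def f_def)
  then have "e \<noteq> f" by metis
  then have lin: "lin_set (\<lambda>_. 0) {e, f} = {\<lambda>j. e j * z e + f j * z f | z. True}"
    by (simp add: lin_set_def)
  have "dominated = lin_set (\<lambda>_. 0) {e, f}"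
  proof (intro equalityI subsetI)
    fix x assume "x \<in> dominated"
    then have x: "\<And>j. j \<ge> 2 \<Longrightarrow> x j = 0" "x 1 \<le> x 0"
      by (auto simp: dominated_def nat_space_def)
    \<comment> \<open>Decompose (x0, x1) as x0 - x1 copies of (1,0) and x1 copies of (1,1); the
      truncated subtraction is exact since x1 \<le> x0.\<close>
    define z where "z = (\<lambda>u. if u = e then x 0 - x 1 else x 1)"
    have "x j = e j * z e + f j * z f" for j
    proof -
      consider "j = 0" | "j = 1" | "j \<ge> 2" by linarith
      then show ?thesis
        using x \<open>e \<noteq> f\<close> by cases (auto simp: z_def, auto simp: e_def f_def)
    qed
    then show "x \<in> lin_set (\<lambda>_. 0) {e, f}" unfolding lin by blast
  next
    fix x assume "x \<in> lin_set (\<lambda>_. 0) {e, f}"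
    then show "x \<in> dominated"
      unfolding lin by (auto simp: dominated_def nat_space_def e_def f_def)
  qed
  moreover have "{e, f} \<subseteq> nat_space 2" "(\<lambda>_. 0) \<in> nat_space 2"
    by (auto simp: nat_space_def e_def f_def)
  ultimately have "is_linear 2 dominated"
    unfolding is_linear_def by (intro exI[of _ "\<lambda>_. 0"] exI[of _ "{e, f}"]) simp
  then show ?thesis
    unfolding is_semilinear_def by (intro exI[of _ "{dominated}"]) simp
qed

lemma parikh_automaton_dominated_pa: "parikh_automaton (dominated_pa a b c)"
  using is_semilinear_dominated
  by (auto simp: parikh_automaton_def dominated_pa_def nat_space_def weight_def)

lemma deterministic_dominated_pa: "deterministic (dominated_pa a b c)"
  unfolding deterministic_def dominated_pa_def by auto

text \<open>The word forces the states and vectors of its run, so acceptance is a statement about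
  the choice of \<open>k\<close> alone.\<close>

lemma weak_reset_language_dominated_pa:
  "\<alpha> \<in> weak_reset_language (dominated_pa a b c) \<longleftrightarrow>
    range \<alpha> \<subseteq> {a, b, c} \<and> (\<exists>k. k 0 = 0 \<and> strict_mono k \<and>
      (\<forall>i. segment_sum (\<lambda>i. weight a b (\<alpha> i)) (k i) (k (Suc i)) \<in> dominated))"
proof -
  have run: "is_run (dominated_pa a b c) \<alpha> p v \<longleftrightarrow>
      range \<alpha> \<subseteq> {a, b, c} \<and> p = (\<lambda>_. 0) \<and> v = (\<lambda>i. weight a b (\<alpha> i))" for p v
  proof
    assume "is_run (dominated_pa a b c) \<alpha> p v"
    then have "\<alpha> i \<in> {a, b, c} \<and> p i = 0 \<and> v i = weight a b (\<alpha> i)" for i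
      unfolding is_run_def dominated_pa_def by (auto simp: image_def)
    then show "range \<alpha> \<subseteq> {a, b, c} \<and> p = (\<lambda>_. 0) \<and> v = (\<lambda>i. weight a b (\<alpha> i))"
      by blast
  next
    assume "range \<alpha> \<subseteq> {a, b, c} \<and> p = (\<lambda>_. 0) \<and> v = (\<lambda>i. weight a b (\<alpha> i))"
    then show "is_run (dominated_pa a b c) \<alpha> p v"
      by (auto simp: is_run_def dominated_pa_def image_subset_iff)
  qed
  have shift: "(\<forall>i\<ge>1. P (i - 1) i) \<longleftrightarrow> (\<forall>i. P i (Suc i))" for P :: "nat \<Rightarrow> nat \<Rightarrow> bool"
    by (metis One_nat_def Suc_le_D diff_Suc_1 le_add1 plus_1_eq_Suc)
  have weak: "weak_reset_accepting (dominated_pa a b c) (\<lambda>_. 0) v \<longleftrightarrow>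
      (\<exists>k. k 0 = 0 \<and> strict_mono k \<and> (\<forall>i. segment_sum v (k i) (k (Suc i)) \<in> dominated))" for v
    using shift[of "\<lambda>i j. segment_sum v (k i) (k j) \<in> dominated" for k]
    by (simp add: weak_reset_accepting_def dominated_pa_def)
  have "alphabet (dominated_pa a b c) = {a, b, c}" by (simp add: dominated_pa_def)
  then show ?thesis
    unfolding weak_reset_language_def mem_Collect_eq run using weak by auto
qed

text \<open>\<open>dominated\<close> contains 0 and is closed under addition. This turns a condition
  on factors into one on arbitrarily long prefixes, which can refute membership.\<close>

lemma segment_sum_prefix_dominated:
  assumes "k 0 = 0" "strict_mono k" "\<And>i. segment_sum v (k i) (k (Suc i)) \<in> dominated"
  shows "segment_sum v 0 (k i) \<in> dominated"
proof (induction i)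
  case 0
  then show ?case using assms(1) by (simp add: segment_sum_def dominated_def nat_space_def)
next
  case (Suc i)
  have "k i \<le> k (Suc i)" using assms(2) by (simp add: strict_mono_less_eq)
  then have "segment_sum v 0 (k (Suc i)) j =
      segment_sum v 0 (k i) j + segment_sum v (k i) (k (Suc i)) j" for j
    by (simp add: segment_sum_def sum.atLeastLessThan_concat)
  then show ?case
    using Suc assms(3)[of i] by (auto simp: dominated_def nat_space_def intro: add_mono)
qed

section \<open>The words a^m b^n c^\<omega> and their letter counts\<close>

definition block_word :: "'a \<Rightarrow> 'a \<Rightarrow> 'a \<Rightarrow> nat \<Rightarrow> nat \<Rightarrow> nat \<Rightarrow> 'a" where
  "block_word a b c m n = (\<lambda>i. if i < m then a else if i < m + n then b else c)"

lemma segment_sum_weight_0: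
  "segment_sum (\<lambda>i. weight a b (\<alpha> i)) m n 0 = card {i \<in> {m..<n}. \<alpha> i = a}"
  by (simp add: segment_sum_def weight_def of_bool_def sum.If_cases Int_def)

lemma segment_sum_weight_1:
  "segment_sum (\<lambda>i. weight a b (\<alpha> i)) m n 1 = card {i \<in> {m..<n}. \<alpha> i = b}"
  by (simp add: segment_sum_def weight_def of_bool_def sum.If_cases Int_def)

lemma segment_sum_weight_dominated_iff:
  "segment_sum (\<lambda>i. weight a b (\<alpha> i)) m n \<in> dominated \<longleftrightarrow>
    card {i \<in> {m..<n}. \<alpha> i = b} \<le> card {i \<in> {m..<n}. \<alpha> i = a}"
proof -
  have "segment_sum (\<lambda>i. weight a b (\<alpha> i)) m n \<in> nat_space 2"
    by (auto simp: nat_space_def segment_sum_def weight_def)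
  then show ?thesis
    by (simp add: dominated_def segment_sum_weight_0 segment_sum_weight_1[unfolded One_nat_def])
qed

lemma card_block_word:
  assumes "a \<noteq> b" "a \<noteq> c" "b \<noteq> c" "N \<ge> m + n"
  shows "card {i \<in> {0..<N}. block_word a b c m n i = a} = m"
    and "card {i \<in> {0..<N}. block_word a b c m n i = b} = n"
proof -
  have "{i \<in> {0..<N}. block_word a b c m n i = a} = {0..<m}"
    "{i \<in> {0..<N}. block_word a b c m n i = b} = {m..<m + n}"
    using assms by (auto simp: block_word_def split: if_splits)
  then show "card {i \<in> {0..<N}. block_word a b c m n i = a} = m"
    "card {i \<in> {0..<N}. block_word a b c m n i = b} = n" by simp_all
qed

lemma block_word_mem_iff:
  assumes "a \<noteq> b" "a \<noteq> c" "b \<noteq> c"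
  shows "block_word a b c m n \<in> weak_reset_language (dominated_pa a b c) \<longleftrightarrow> n \<le> m"
proof
  assume "block_word a b c m n \<in> weak_reset_language (dominated_pa a b c)"
  then obtain k where k: "k 0 = 0" "strict_mono k"
      "\<And>i. segment_sum (\<lambda>i. weight a b (block_word a b c m n i)) (k i) (k (Suc i)) \<in> dominated"
    unfolding weak_reset_language_dominated_pa by blast
  \<comment> \<open>Strict monotonicity gives \<open>k (m + n) \<ge> m + n\<close>, so this prefix
    contains both blocks.\<close>
  show "n \<le> m"
    using segment_sum_prefix_dominated[OF k, of "m + n"]
      card_block_word[OF assms strict_mono_imp_increasing[OF k(2), of "m + n"]]
    by (simp add: segment_sum_weight_dominated_iff)
next
  assume "n \<le> m"
  \<comment> \<open>The first factor takes both blocks and one \<open>c\<close>, so it is nonempty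
    even for \<open>m = n = 0\<close>; every later factor is a single \<open>c\<close>.\<close>
  define k where "k i = (if i = 0 then 0 else m + n + i)" for i
  have "segment_sum (\<lambda>i. weight a b (block_word a b c m n i)) (k i) (k (Suc i)) \<in> dominated" for i
  proof (cases "i = 0")
    case True
    then show ?thesis
      using \<open>n \<le> m\<close> card_block_word[OF assms, of m n "m + n + 1"]
      by (simp add: segment_sum_weight_dominated_iff k_def)
  next
    case False
    then have empty: "{j \<in> {k i..<k (Suc i)}. block_word a b c m n j = b} = {}"
      using assms by (auto simp: k_def block_word_def)
    show ?thesis unfolding segment_sum_weight_dominated_iff empty by simp
  qed
  moreover have "strict_mono k" by (simp add: strict_mono_Suc_iff k_def)
  moreover have "range (block_word a b c m n) \<subseteq> {a, b, c}" by (auto simp: block_word_def)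
  ultimately show "block_word a b c m n \<in> weak_reset_language (dominated_pa a b c)"
    unfolding weak_reset_language_dominated_pa by (auto intro!: exI[of _ k] simp: k_def)
qed

text \<open>Cut after every letter: each factor is a single \<open>a\<close>.\<close>

lemma const_mem_weak_reset_language_dominated_pa:
  assumes "a \<noteq> b"
  shows "(\<lambda>_. a) \<in> weak_reset_language (dominated_pa a b c)"
  unfolding weak_reset_language_dominated_pa segment_sum_weight_dominated_iff
  using assms by (auto intro!: exI[of _ "\<lambda>i. i"] simp: strict_mono_def)

section \<open>Separation from the deterministic strong class\<close>

lemma weak_reset_language_dominated_pa_not_strong:
  assumes "a \<noteq> b" "a \<noteq> c" "b \<noteq> c"
  shows "weak_reset_language (dominated_pa a b c) \<notin> det_strong_reset_languages"
proof
  assume "weak_reset_language (dominated_pa a b c) \<in> det_strong_reset_languages"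
  then obtain A :: "(nat, 'a) pa" where A: "parikh_automaton A" "deterministic A"
    and L: "weak_reset_language (dominated_pa a b c) = strong_reset_language A"
    unfolding det_strong_reset_languages_def by blast
  have "(\<lambda>_. a) \<in> strong_reset_language A"
    using const_mem_weak_reset_language_dominated_pa[OF assms(1)] L by blast
  then obtain m n where "m < n"
    and ex: "\<And>\<beta>. \<beta> \<in> strong_reset_language A \<Longrightarrow> (\<And>i. i < n \<Longrightarrow> \<beta> i = a) \<Longrightarrow>
      splice_at m n (\<lambda>_. a) \<beta> \<in> strong_reset_language A"
    using strong_reset_language_exchange[OF A] by blast
  \<comment> \<open>The balanced word a^n b^n c^\<omega> begins with \<open>n\<close> letters
    \<open>a\<close>, so the exchange applies to it.\<close>
  have "splice_at m n (\<lambda>_. a) (block_word a b c n n) \<in> strong_reset_language A"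
    using block_word_mem_iff[OF assms, of n n] L by (intro ex) (auto simp: block_word_def)
  \<comment> \<open>The exchange removes \<open>n - m\<close> leading letters \<open>a\<close> and
    leaves all \<open>n\<close> letters \<open>b\<close>.\<close>
  moreover have "splice_at m n (\<lambda>_. a) (block_word a b c n n) = block_word a b c m n"
    by (auto simp: fun_eq_iff splice_at_def block_word_def)
  ultimately show False
    using block_word_mem_iff[OF assms, of m n] L \<open>m < n\<close> by simp
qed

theorem lemma17:
  "(det_strong_reset_languages :: (nat \<Rightarrow> 'a::infinite) set set) \<subset> det_weak_reset_languages"
proof -
  \<comment> \<open>The infinite letter type supplies three distinct letters; the automaton itself
    uses only these.\<close>
  obtain a b c :: 'a where abc: "b \<notin> {a}" "c \<notin> {a, b}"
    by (metis ex_new_if_finite finite.emptyI finite.insertI infinite_UNIV)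
  have "weak_reset_language (dominated_pa a b c) \<in> det_weak_reset_languages"
    by (rule det_weak_reset_languagesI[OF parikh_automaton_dominated_pa deterministic_dominated_pa])
  moreover have "weak_reset_language (dominated_pa a b c) \<notin> det_strong_reset_languages"
    using abc by (intro weak_reset_language_dominated_pa_not_strong) auto
  ultimately show ?thesis using det_strong_reset_languages_subset_weak by blast
qed

end
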